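(* Let $m,n$ be positive integers. Then: (i) $\bigcup_{\boldsymbol{\gamma}\in[0,1)^{m}}\Omega^{\boldsymbol{\gamma}}(m,n)=[0,1)^{m\times n}\setminus\mathbf{Bad}^{\boldsymbol{0}}(m,n)$; equivalently, for $A\in[0,1)^{m\times n}$, $\Omega_A(m,n)=\emptyset$ if and only if $A\in\mathbf{Bad}^{\boldsymbol{0}}(m,n)$. (ii) For every $\boldsymbol{\gamma}\in[0,1)^{m}$, $\mu_{mn}(\Omega^{\boldsymbol{\gamma}}(m,n))=0$. (iii) For every $A\in[0,1)^{m\times n}$, $\mu_{m}(\Omega_{A}(m,n))=0$.
   Context: $[0,1)^{m\times n}$ is the set of real $m\times n$ matrices with entries in $[0,1)$. For $\boldsymbol{x}\in\mathbb{R}^n$, $\|\boldsymbol{x}\|=\max_i|x_i|$; for $\boldsymbol{y}\in\mathbb{R}^m$, $\langle\boldsymbol{y}\rangle=\min_{\boldsymbol{p}\in\mathbb{Z}^m}\|\boldsymbol{y}-\boldsymbol{p}\|$. For $\psi:\mathbb{N}\to[0,\infty)$, $W_{m,n}(\psi)$ is the set of pairs $(A,\boldsymbol{\gamma})\in[0,1)^{m\times n}\times[0,1)^m$ such that $\langle A\boldsymbol{q}-\boldsymbol{\gamma}\rangle<\psi(\|\boldsymbol{q}\|)$ for infinitely many $\boldsymbol{q}\in\mathbb{Z}^n$. "Decreasing" means non-increasing. $\mathcal{D}$ is the set of decreasing $\psi:\mathbb{N}\to[0,\infty)$ with $\sum_{q\ge1}q^{n-1}\psi(q)^m=\infty$.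 $\Omega(m,n)=\bigcap_{\psi\in\mathcal{D}}W_{m,n}(\psi)$, $\Omega^{\boldsymbol{\gamma}}(m,n)=\{A:(A,\boldsymbol{\gamma})\in\Omega(m,n)\}$, $\Omega_A(m,n)=\{\boldsymbol{\gamma}\in[0,1)^m:(A,\boldsymbol{\gamma})\in\Omega(m,n)\}$. $\mathbf{Bad}^{\boldsymbol{0}}(m,n)=\{A\in[0,1)^{m\times n}:\liminf_{\boldsymbol{q}\in\mathbb{Z}^n,\|\boldsymbol{q}\|\to\infty}\|\boldsymbol{q}\|^n\langle A\boldsymbol{q}\rangle^m>0\}$. $\mu_l$ denotes $l$-dimensional Lebesgue measure. *)

theory Defs
  imports "HOL-Analysis.Analysis"
begin

text \<open>Dimensions m = CARD('m), n = CARD('n) (positive integers, automatically).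
  Matrices A :: real^'n^'m (rows indexed by 'm), A $ i $ j the (i,j) entry.\<close>

definition supnorm :: "real^'k \<Rightarrow> real" where
  "supnorm x = Max (range (\<lambda>i. \<bar>x $ i\<bar>))"

definition isupnorm :: "int^'k \<Rightarrow> nat" where
  "isupnorm q = nat (Max (range (\<lambda>i. \<bar>q $ i\<bar>)))"

definition ivec :: "int^'k \<Rightarrow> real^'k" where
  "ivec q = (\<chi> i. of_int (q $ i))"

definition distZ :: "real^'k \<Rightarrow> real" where
  "distZ y = Inf {supnorm (y - ivec p) | p :: int^'k. True}"

definition unit_cube :: "(real^'k) set" where
  "unit_cube = {x. \<forall>i. 0 \<le> x $ i \<and> x $ i < 1}"

definition unit_mat :: "(real^'n^'m) set" where
  "unit_mat = {A. \<forall>i j. 0 \<le> A $ i $ j \<and> A $ i $ j < 1}"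

definition W :: "(nat \<Rightarrow> real) \<Rightarrow> ((real^'n^'m) \<times> (real^'m)) set" where
  "W \<psi> = {(A, \<gamma>). A \<in> unit_mat \<and> \<gamma> \<in> unit_cube \<and>
      infinite {q :: int^'n. distZ (A *v ivec q - \<gamma>) < \<psi> (isupnorm q)}}"

text \<open>Decreasing (non-increasing) \<psi> : \<nat> = {1,2,...} \<rightarrow> [0,\<infinity>) with divergent
  sum \<Sum>_{q\<ge>1} q^(n-1) \<psi>(q)^m. The value at 0 is irrelevant.\<close>
definition DD :: "'m itself \<Rightarrow> 'n itself \<Rightarrow> (nat \<Rightarrow> real) set" where
  "DD _ _ = {\<psi>. (\<forall>q\<ge>1. 0 \<le> \<psi> q) \<and> (\<forall>a b. 1 \<le> a \<longrightarrow> a \<le> b \<longrightarrow> \<psi> b \<le> \<psi> a) \<and>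
      \<not> summable (\<lambda>k. real (Suc k) ^ (CARD('n) - 1) * \<psi> (Suc k) ^ CARD('m))}"

definition Omega :: "((real^'n^'m) \<times> (real^'m)) set" where
  "Omega = (\<Inter>\<psi>\<in>DD TYPE('m) TYPE('n). W \<psi>)"

definition Omega_gamma :: "real^'m \<Rightarrow> (real^'n^'m) set" where
  "Omega_gamma \<gamma> = {A. (A, \<gamma>) \<in> Omega}"

definition Omega_A :: "real^'n^'m \<Rightarrow> (real^'m) set" where
  "Omega_A A = {\<gamma>. (A, \<gamma>) \<in> Omega}"

text \<open>Bad^0(m,n): liminf over q \<in> \<int>^n, \<parallel>q\<parallel> \<rightarrow> \<infinity> (the cofinite filter on \<int>^n)
  of \<parallel>q\<parallel>^n \<langle>Aq\<rangle>^m is positive.\<close>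
definition Bad0 :: "(real^'n^'m) set" where
  "Bad0 = {A \<in> unit_mat. Liminf cofinite
      (\<lambda>q :: int^'n. ereal (real (isupnorm q) ^ CARD('n) * distZ (A *v ivec q) ^ CARD('m))) > 0}"

end

theory Submission
  imports Defs
begin

text \<open>For fixed \<open>(A, \<gamma>)\<close> and \<open>d q = distZ (A q - \<gamma>)\<close>, the function \<open>\<psi> k = min {d q | \<parallel>q\<parallel> \<le> k}\<close> is
  decreasing and admits no solution. Hence if \<open>(A, \<gamma>)\<close> lies in \<open>Omega\<close>, then its series converges,
  and by monotonicity \<open>k\<^sup>n (\<psi> k)\<^sup>m \<rightarrow> 0\<close>: for every \<open>c > 0\<close> and all large \<open>k\<close> some \<open>q\<close> with
  \<open>\<parallel>q\<parallel> \<le> k\<close> satisfies \<open>k\<^sup>n (d q)\<^sup>m < c\<close>. If \<open>A\<close> is badly approximable, two such \<open>q\<close> cannot coexist for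
  small \<open>c\<close>, so that \<open>q\<close> does not depend on \<open>k\<close>; yet the same argument applies with this \<open>q\<close> removed,
  a contradiction. For random \<open>\<gamma>\<close> or random \<open>A\<close> the condition at level \<open>k\<close> has probability \<open>O(c)\<close> by
  the union bound, and \<open>c\<close> is arbitrary, so \<open>Omega\<close> has null sections. If \<open>A\<close> is not badly
  approximable, a \<open>\<gamma>\<close> in \<open>Omega_A A\<close> is the sum modulo 1 of \<open>A q\<^sub>j\<close> over a very sparse sequence of
  very good approximations \<open>q\<^sub>j\<close>.\<close>

subsection \<open>Norms and distance to the integer lattice\<close>

lemma supnorm_less_iff: "supnorm x < d \<longleftrightarrow> (\<forall>i. \<bar>x $ i\<bar> < d)"
  by (simp add: supnorm_def)

lemma isupnorm_le_iff: "isupnorm q \<le> k \<longleftrightarrow> (\<forall>i. \<bar>q $ i\<bar> \<le> int k)"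
  by (simp add: isupnorm_def nat_le_iff)

lemma isupnorm_abs_le: "\<bar>q $ i\<bar> \<le> int (isupnorm q)"
  using isupnorm_le_iff by blast

lemma isupnorm_add_le: "isupnorm (a + b) \<le> isupnorm a + isupnorm b"
  unfolding isupnorm_le_iff
  by (auto intro: order_trans[OF abs_triangle_ineq] add_mono isupnorm_abs_le)

lemma isupnorm_minus: "isupnorm (- a) = isupnorm a"
  by (simp add: isupnorm_def)

lemma isupnorm_diff_le: "isupnorm (a - b) \<le> isupnorm a + isupnorm b"
  using isupnorm_add_le[of a "- b"] by (simp add: isupnorm_minus)

lemma isupnorm_scale: "isupnorm (of_nat k *s q) = k * isupnorm q"
proof (cases "k = 0")
  case False
  show ?thesis
  proof (rule antisym)
    show "isupnorm (of_nat k *s q) \<le> k * isupnorm q"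
      unfolding isupnorm_le_iff by (auto simp: abs_mult intro: mult_left_mono isupnorm_abs_le)
    obtain i where "isupnorm q = nat \<bar>q $ i\<bar>"
      unfolding isupnorm_def using Max_in[of "range (\<lambda>i. \<bar>q $ i\<bar>)"] by fastforce
    then have "int (k * isupnorm q) = \<bar>(of_nat k *s q) $ i\<bar>"
      by (simp add: abs_mult)
    then show "k * isupnorm q \<le> isupnorm (of_nat k *s q)"
      using isupnorm_abs_le[of "of_nat k *s q" i] by linarith
  qed
qed (simp add: isupnorm_def)

lemma isupnorm_pos_iff: "0 < isupnorm q \<longleftrightarrow> q \<noteq> 0"
  using isupnorm_le_iff[of q 0] by (auto simp: vec_eq_iff)

section \<open>Counting integer vectors in boxes and balls\<close>

lemma int_vec_box:
  fixes S :: "'k::finite \<Rightarrow> int set"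
  assumes "\<And>i. finite (S i)"
  shows "finite {q :: int^'k. \<forall>i. q $ i \<in> S i}"
    and "card {q :: int^'k. \<forall>i. q $ i \<in> S i} = (\<Prod>i\<in>UNIV. card (S i))"
proof -
  have eq: "{q :: int^'k. \<forall>i. q $ i \<in> S i} = vec_lambda ` (\<Pi>\<^sub>E i\<in>UNIV. S i)"
    by (auto simp: PiE_UNIV_domain image_iff vec_eq_iff intro: exI[of _ "($) _"])
  show "finite {q :: int^'k. \<forall>i. q $ i \<in> S i}"
    unfolding eq using assms by (intro finite_imageI finite_PiE) auto
  have "inj_on vec_lambda (\<Pi>\<^sub>E i\<in>UNIV. S i)"
    by (metis injI inj_on_subset subset_UNIV vec_lambda_inject UNIV_I)
  then show "card {q :: int^'k. \<forall>i. q $ i \<in> S i} = (\<Prod>i\<in>UNIV. card (S i))"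
    unfolding eq by (simp add: card_image card_PiE)
qed

lemma isupnorm_ball_eq: "{q. isupnorm q \<le> k} = {q. \<forall>i. q $ i \<in> {- int k..int k}}"
  by (auto simp: isupnorm_le_iff abs_le_iff minus_le_iff)

lemma finite_isupnorm_ball: "finite {q :: int^'k. isupnorm q \<le> k}"
  unfolding isupnorm_ball_eq by (rule int_vec_box) simp

lemma card_isupnorm_ball: "card {q :: int^'k. isupnorm q \<le> k} = (2 * k + 1) ^ CARD('k)"
proof -
  have "nat (int k + int k + 1) = 2 * k + 1" by linarith
  then show ?thesis
    unfolding isupnorm_ball_eq by (subst int_vec_box) (auto simp: algebra_simps)
qed

lemma infinite_isupnorm_gt:
  assumes "infinite (S :: (int^'k) set)"
  obtains q where "q \<in> S" "N < isupnorm q"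
  using assms finite_subset[OF _ finite_isupnorm_ball[of N], of S] by (force simp: not_less)

section \<open>Distance to the integer lattice\<close>

lemma ivec_nth [simp]: "ivec q $ i = of_int (q $ i)"
  by (simp add: ivec_def)

lemma ivec_diff: "ivec (a - b) = ivec a - ivec b"
  by (simp add: vec_eq_iff)

lemma ivec_sum: "ivec (\<Sum>j\<in>S. f j) = (\<Sum>j\<in>S. ivec (f j))"
  by (simp add: vec_eq_iff)

text \<open>A strict bound on an infimum is witnessed by a single lattice point, so later facts on
  \<open>distZ\<close> can argue with witnesses instead of with \<open>Inf\<close>.\<close>

lemma distZ_less_iff: "distZ y < d \<longleftrightarrow> (\<exists>p :: int^'k. \<forall>i. \<bar>y $ i - of_int (p $ i)\<bar> < d)"
  for y :: "real^'k"
proof -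
  have "0 \<le> supnorm x" for x :: "real^'k"
    using supnorm_less_iff[of x 0] by fastforce
  then have "bdd_below {supnorm (y - ivec p) | p :: int^'k. True}"
    by (intro bdd_belowI[of _ 0]) auto
  then have "distZ y < d \<longleftrightarrow> (\<exists>p :: int^'k. supnorm (y - ivec p) < d)"
    unfolding distZ_def by (subst cInf_less_iff) auto
  then show ?thesis by (simp add: supnorm_less_iff)
qed

lemma distZ_nonneg: "0 \<le> distZ y"
  using distZ_less_iff[of y 0] by fastforce

lemma distZ_le:
  fixes y :: "real^'k" and p :: "int^'k"
  assumes "\<And>i. \<bar>y $ i - of_int (p $ i)\<bar> \<le> d"
  shows "distZ y \<le> d"
proof (rule dense_ge)
  fix e assume "d < e"
  then have "\<forall>i. \<bar>y $ i - of_int (p $ i)\<bar> < e" using assms le_less_trans by blast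
  then show "distZ y \<le> e" using distZ_less_iff[of y e] by (meson less_imp_le)
qed

lemma distZ_add_le: "distZ (x + y) \<le> distZ x + distZ y" for x :: "real^'k"
proof (rule field_le_epsilon)
  fix e :: real assume "0 < e"
  then obtain p r :: "int^'k" where
    p: "\<And>i. \<bar>x $ i - of_int (p $ i)\<bar> < distZ x + e / 2" and
    r: "\<And>i. \<bar>y $ i - of_int (r $ i)\<bar> < distZ y + e / 2"
    using distZ_less_iff[of x "distZ x + e / 2"] distZ_less_iff[of y "distZ y + e / 2"] by auto
  have "\<bar>(x + y) $ i - of_int ((p + r) $ i)\<bar> \<le> distZ x + distZ y + e" for i
    using p[of i] r[of i] by (simp add: abs_if split: if_splits)
  then show "distZ (x + y) \<le> distZ x + distZ y + e" by (rule distZ_le)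
qed

lemma distZ_minus: "distZ (- y) = distZ y" for y :: "real^'k"
proof -
  have "distZ (- x) < d" if x: "distZ x < d" for x :: "real^'k" and d
  proof -
    obtain p :: "int^'k" where "\<forall>i. \<bar>x $ i - of_int (p $ i)\<bar> < d"
      using x unfolding distZ_less_iff by blast
    then have "\<forall>i. \<bar>(- x) $ i - of_int ((- p) $ i)\<bar> < d"
      by (simp add: abs_minus_commute)
    then show ?thesis unfolding distZ_less_iff by (rule exI)
  qed
  from this[of y "distZ (- y)"] this[of "- y" "distZ y"] show ?thesis
    by force
qed

lemma distZ_diff_le: "distZ (x - y) \<le> distZ x + distZ y"
  using distZ_add_le[of x "- y"] by (simp add: distZ_minus)

lemma distZ_ivec: "distZ (ivec p) = 0"
  using distZ_le[of "ivec p" p 0] distZ_nonneg[of "ivec p"] by simp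

text \<open>Condensation: the block of terms with index between k/2 and k has at least k/2 terms,
  each at least (k/2)^(n-1) g(k), so smallness of Cauchy blocks bounds (k/2)^n g(k). The threshold c
  / 2^n absorbs the factor 2^n.\<close>

lemma summable_decreasing_tendsto_0:
  fixes g :: "nat \<Rightarrow> real"
  assumes nonneg: "\<And>k. 1 \<le> k \<Longrightarrow> 0 \<le> g k"
    and dec: "\<And>a b. 1 \<le> a \<Longrightarrow> a \<le> b \<Longrightarrow> g b \<le> g a"
    and sm: "summable (\<lambda>k. real (Suc k) ^ (n - 1) * g (Suc k))"
    and "0 < n" "0 < c"
  shows "\<forall>\<^sub>F k in sequentially. real k ^ n * g k < c"
proof -
  let ?f = "\<lambda>k. real (Suc k) ^ (n - 1) * g (Suc k)"
  have "0 < c / 2 ^ n" using \<open>0 < c\<close> by simp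
  then obtain N where N: "\<And>a b. a \<ge> N \<Longrightarrow> norm (sum ?f {a..<b}) < c / 2 ^ n"
    using sm[unfolded summable_Cauchy] by meson
  have "real k ^ n * g k < c" if k: "k \<ge> max 1 (2 * N)" for k
  proof -
    have "(real k / 2) ^ n * g k = (real k / 2) * ((real k / 2) ^ (n - 1) * g k)"
      using \<open>0 < n\<close> by (simp add: power_eq_if)
    also have "\<dots> \<le> real (card {k div 2..<k}) * ((real k / 2) ^ (n - 1) * g k)"
      using k nonneg[of k] by (intro mult_right_mono) auto
    also have "\<dots> = (\<Sum>j\<in>{k div 2..<k}. (real k / 2) ^ (n - 1) * g k)" by simp
    also have "\<dots> \<le> sum ?f {k div 2..<k}"
    proof (rule sum_mono)
      fix j assume j: "j \<in> {k div 2..<k}"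
      have "real k / 2 \<le> real (Suc j)" using j by auto
      then show "(real k / 2) ^ (n - 1) * g k \<le> ?f j"
        using j k nonneg[of k] by (intro mult_mono power_mono dec) auto
    qed
    also have "\<dots> < c / 2 ^ n"
    proof -
      have "N \<le> k div 2" using k by (simp add: less_eq_div_iff_mult_less_eq mult.commute)
      then show ?thesis using N[of "k div 2" k] by (simp only: real_norm_def abs_less_iff)
    qed
    finally show ?thesis by (simp add: power_divide field_simps)
  qed
  then show ?thesis unfolding eventually_sequentially by blast
qed

subsection \<open>Uniform approximation at points of Omega\<close>

text \<open>The box constraints are inherited from any single \<open>W \<psi>\<close>, so it is
  enough that \<open>DD\<close> is nonempty; the constant 1 is a member.\<close>

lemma Omega_unit:
  assumes "(A, \<gamma>) \<in> (Omega :: ((real^'n^'m) \<times> (real^'m)) set)"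
  shows "A \<in> unit_mat" "\<gamma> \<in> unit_cube"
proof -
  have "\<not> summable (\<lambda>k. real (Suc k) ^ (CARD('n) - 1) * 1 ^ CARD('m))"
  proof
    assume "summable (\<lambda>k. real (Suc k) ^ (CARD('n) - 1) * 1 ^ CARD('m))"
    then have "(\<lambda>k. real (Suc k) ^ (CARD('n) - 1)) \<longlonglongrightarrow> 0"
      using summable_LIMSEQ_zero by fastforce
    then obtain k where "real (Suc k) ^ (CARD('n) - 1) < 1"
      using order_tendstoD(2)[of _ 0 sequentially 1] eventually_sequentially by fastforce
    then show False using one_le_power[of "real (Suc k)" "CARD('n) - 1"] by linarith
  qed
  then have "(\<lambda>_. 1) \<in> DD TYPE('m) TYPE('n)" by (simp add: DD_def)
  then have "(A, \<gamma>) \<in> W (\<lambda>_. 1)" using assms by (auto simp: Omega_def)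
  then show "A \<in> unit_mat" "\<gamma> \<in> unit_cube" by (auto simp: W_def)
qed

text \<open>Discarding a finite set \<open>X\<close> serves two purposes: it drops q = 0 in the
  measure estimates, and it forces a second approximant when \<open>A\<close> is badly
  approximable.\<close>

lemma Omega_uniform:
  fixes A :: "real^'n^'m"
  assumes "(A, \<gamma>) \<in> Omega" and "finite X" and "0 < c"
  shows "\<forall>\<^sub>F k in sequentially. \<exists>q. q \<notin> X \<and> isupnorm q \<le> k \<and>
    real k ^ CARD('n) * distZ (A *v ivec q - \<gamma>) ^ CARD('m) < c"
proof -
  define d where "d q = distZ (A *v ivec q - \<gamma>)" for q
  \<comment> \<open>The inserted 1 keeps the minimum defined when the ball contains no vector
    outside \<open>X\<close>.\<close>
  define S where "S k = insert 1 (d ` {q. q \<notin> X \<and> isupnorm q \<le> k})" for k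
  define E where "E k = Min (S k)" for k
  have fin: "finite (S k)" for k
    unfolding S_def
    by (intro finite.insertI finite_imageI finite_subset[OF _ finite_isupnorm_ball[of k]]) auto
  have ne: "S k \<noteq> {}" for k by (simp add: S_def)
  have nonneg: "0 \<le> E k" for k
    unfolding E_def using fin ne by (subst Min_ge_iff) (auto simp: S_def d_def distZ_nonneg)
  have dec: "E b \<le> E a" if "a \<le> b" for a b
    unfolding E_def using that fin ne by (intro Min_antimono) (auto simp: S_def)
  have E_le: "E (isupnorm q) \<le> d q" if "q \<notin> X" for q
    unfolding E_def using that fin by (intro Min_le) (auto simp: S_def)
  have "{q. d q < E (isupnorm q)} \<subseteq> X"
    using E_le by (force simp: not_less[symmetric])
  then have "finite {q. d q < E (isupnorm q)}"
    using \<open>finite X\<close> finite_subset by blast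
  then have "(A, \<gamma>) \<notin> W E"
    by (simp add: W_def d_def)
  then have "E \<notin> DD TYPE('m) TYPE('n)"
    using assms(1) by (auto simp: Omega_def)
  then have "summable (\<lambda>k. real (Suc k) ^ (CARD('n) - 1) * E (Suc k) ^ CARD('m))"
    using nonneg dec by (auto simp: DD_def)
  \<comment> \<open>The bound 1 in \<open>min c 1\<close> rules out the cap value:
    \<open>E k = 1\<close> would give k^n < 1. Hence the minimum comes from an actual
    vector.\<close>
  then have "\<forall>\<^sub>F k in sequentially. real k ^ CARD('n) * E k ^ CARD('m) < min c 1"
    using nonneg dec \<open>0 < c\<close>
    by (intro summable_decreasing_tendsto_0[where g = "\<lambda>k. E k ^ CARD('m)"])
       (auto intro: power_mono)
  then show ?thesis
    using eventually_ge_at_top[of 1]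
  proof eventually_elim
    case (elim k)
    have "E k \<in> S k" unfolding E_def using fin ne by (rule Min_in)
    moreover have "E k \<noteq> 1"
    proof
      assume "E k = 1"
      then have "real k ^ CARD('n) < 1" using elim by simp
      then show False using one_le_power[of "real k" "CARD('n)"] elim by linarith
    qed
    ultimately obtain q where "q \<notin> X" "isupnorm q \<le> k" "E k = d q"
      by (auto simp: S_def)
    then show ?case using elim by (auto simp: d_def)
  qed
qed

text \<open>The liminf controls all but finitely many q. At an exceptional q \<noteq> 0 the product
  is still positive: if it vanished, so would the distance at every multiple of q, giving infinitely
  many exceptions. A minimum over the exceptions then yields a uniform constant.\<close>

lemma Bad0_uniform:
  fixes A :: "real^'n^'m"
  assumes "A \<in> Bad0"
  obtains c where "0 < c"
    "\<And>q. q \<noteq> 0 \<Longrightarrow> c \<le> real (isupnorm q) ^ CARD('n) * distZ (A *v ivec q) ^ CARD('m)"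
proof -
  define f where "f q = real (isupnorm q) ^ CARD('n) * distZ (A *v ivec q) ^ CARD('m)" for q
  have "0 < Liminf cofinite (\<lambda>q. ereal (f q))"
    using assms by (simp add: Bad0_def f_def)
  then obtain e where e: "0 < e" "e < Liminf cofinite (\<lambda>q. ereal (f q))"
    using dense by blast
  then have "\<forall>\<^sub>F q in cofinite. e < ereal (f q)"
    using less_LiminfD by blast
  then have fin: "finite {q. \<not> e < ereal (f q)}"
    by (simp add: eventually_cofinite)
  have pos: "0 < f q" if "q \<noteq> 0" for q
  proof (rule ccontr)
    assume "\<not> 0 < f q"
    moreover have "0 < isupnorm q" using that isupnorm_pos_iff by blast
    ultimately have "distZ (A *v ivec q) = 0"
      using distZ_nonneg[of "A *v ivec q"] unfolding f_def
      by (metis less_eq_real_def mult_pos_pos of_nat_0_less_iff zero_less_power)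
    then have mult: "distZ (A *v ivec (of_nat k *s q)) = 0" for k
    proof (induction k)
      case 0
      have "A *v ivec (of_nat 0 *s q) = ivec 0"
        by (simp add: vec_eq_iff matrix_vector_mult_def)
      then show ?case by (simp only: distZ_ivec)
    next
      case (Suc k)
      have "A *v ivec (of_nat (Suc k) *s q) = A *v ivec (of_nat k *s q) + A *v ivec q"
        by (simp add: vec_eq_iff matrix_vector_mult_def algebra_simps sum.distrib)
      then have "distZ (A *v ivec (of_nat (Suc k) *s q)) \<le> 0"
        using Suc distZ_add_le[of "A *v ivec (of_nat k *s q)" "A *v ivec q"] by simp
      then show ?case using distZ_nonneg by (rule antisym)
    qed
    have "inj (\<lambda>k. of_nat k *s q)"
    proof (rule injI)
      fix a b assume "of_nat a *s q = of_nat b *s q"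
      then have "a * isupnorm q = b * isupnorm q" by (metis isupnorm_scale)
      then show "a = b" using \<open>0 < isupnorm q\<close> by simp
    qed
    then have "infinite (range (\<lambda>k. of_nat k *s q))"
      using finite_imageD by blast
    moreover have "range (\<lambda>k. of_nat k *s q) \<subseteq> {q. \<not> e < ereal (f q)}"
      using mult e(1) by (auto simp: f_def not_less power_0_left simp flip: zero_ereal_def)
    ultimately show False using fin finite_subset by blast
  qed
  \<comment> \<open>\<open>e\<close> is an extended real, while the constant sought is real.\<close>
  obtain c0 where c0: "0 < c0" "ereal c0 < e"
    using e(1) by (metis ereal_dense2 ereal_less(2))
  define c where "c = Min (insert c0 (f ` ({q. \<not> e < ereal (f q)} - {0})))"
  show thesis
  proof (rule that[of c])
    show "0 < c" unfolding c_def using fin c0 pos by (subst Min_gr_iff) auto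
    show "c \<le> real (isupnorm q) ^ CARD('n) * distZ (A *v ivec q) ^ CARD('m)" if "q \<noteq> 0" for q
    proof (cases "e < ereal (f q)")
      case True
      then have "c0 \<le> f q" using c0(2) by (metis less_ereal.simps(1) less_imp_le order_less_trans)
      moreover have "c \<le> c0" unfolding c_def using fin by (intro Min_le) auto
      ultimately show ?thesis by (simp add: f_def)
    next
      case False
      then have "c \<le> f q" unfolding c_def using fin that by (intro Min_le) auto
      then show ?thesis by (simp add: f_def)
    qed
  qed
qed

lemma Bad0_not_Omega:
  fixes A :: "real^'n^'m"
  assumes "A \<in> Bad0"
  shows "(A, \<gamma>) \<notin> Omega"
proof
  assume Om: "(A, \<gamma>) \<in> Omega"
  obtain c where c: "0 < c"
    "\<And>q. q \<noteq> 0 \<Longrightarrow> c \<le> real (isupnorm q) ^ CARD('n) * distZ (A *v ivec q) ^ CARD('m)"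
    by (rule Bad0_uniform[OF assms]) blast
  define d where "d q = distZ (A *v ivec q - \<gamma>)" for q
  \<comment> \<open>Two vectors of norm at most 2k differ by one of norm at most 4k, whose distance
    is at most twice the larger of the two distances. The factors 4^n and 2^m compensate for this,
    so two distinct approximants would contradict the lower bound c.\<close>
  define b where "b = c / (4 ^ CARD('n) * 2 ^ CARD('m))"
  have "0 < b" using c(1) by (simp add: b_def)
  \<comment> \<open>Radius 2k instead of k allows the choices made at k and k + 1 to be compared at
    scale k, since k + 1 \<le> 2k.\<close>
  have uniq: "q = r"
    if qr: "isupnorm q \<le> 2 * k" "isupnorm r \<le> 2 * k"
      "real k ^ CARD('n) * d q ^ CARD('m) < b" "real k ^ CARD('n) * d r ^ CARD('m) < b" for q r k
  proof (rule ccontr)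
    assume "q \<noteq> r"
    have nn: "0 \<le> d x" for x by (simp add: d_def distZ_nonneg)
    have "A *v ivec (q - r) = (A *v ivec q - \<gamma>) - (A *v ivec r - \<gamma>)"
      by (simp add: ivec_diff matrix_vector_mult_diff_distrib)
    then have "distZ (A *v ivec (q - r)) \<le> d q + d r"
      unfolding d_def by (simp only: distZ_diff_le)
    then have "distZ (A *v ivec (q - r)) \<le> 2 * max (d q) (d r)" by linarith
    then have dist: "distZ (A *v ivec (q - r)) ^ CARD('m) \<le> (2 * max (d q) (d r)) ^ CARD('m)"
      using distZ_nonneg by (rule power_mono)
    have "isupnorm (q - r) \<le> 4 * k"
      using isupnorm_diff_le[of q r] qr(1,2) by linarith
    then have "real (isupnorm (q - r)) \<le> 4 * real k" by linarith
    then have norm: "real (isupnorm (q - r)) ^ CARD('n) \<le> (4 * real k) ^ CARD('n)"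
      by (intro power_mono) auto
    have "c \<le> real (isupnorm (q - r)) ^ CARD('n) * distZ (A *v ivec (q - r)) ^ CARD('m)"
      using \<open>q \<noteq> r\<close> by (intro c(2)) simp
    also have "\<dots> \<le> (4 * real k) ^ CARD('n) * (2 * max (d q) (d r)) ^ CARD('m)"
      using norm dist by (intro mult_mono) (auto simp: distZ_nonneg)
    also have "\<dots> = 4 ^ CARD('n) * 2 ^ CARD('m) * (real k ^ CARD('n) * max (d q) (d r) ^ CARD('m))"
      by (simp add: power_mult_distrib)
    also have "\<dots> < 4 ^ CARD('n) * 2 ^ CARD('m) * b"
      using qr(3,4) by (intro mult_strict_left_mono) (auto simp: max_def)
    finally show False by (simp add: b_def)
  qed
  obtain K where K: "1 \<le> K"
    "\<And>k. k \<ge> K \<Longrightarrow> \<exists>q. isupnorm q \<le> k \<and> real k ^ CARD('n) * d q ^ CARD('m) < b"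
    using eventually_conj[OF Omega_uniform[OF Om finite.emptyI \<open>0 < b\<close>] eventually_ge_at_top[of 1]]
    unfolding eventually_sequentially d_def by (metis order_refl)
  then obtain q where q: "\<And>k. k \<ge> K \<Longrightarrow> isupnorm (q k) \<le> k"
    "\<And>k. k \<ge> K \<Longrightarrow> real k ^ CARD('n) * d (q k) ^ CARD('m) < b"
    by metis
  have const: "q k = q K" if "k \<ge> K" for k
    using that
  proof (induction k rule: dec_induct)
    case (step k)
    have "real k ^ CARD('n) * d (q (Suc k)) ^ CARD('m)
        \<le> real (Suc k) ^ CARD('n) * d (q (Suc k)) ^ CARD('m)"
      by (intro mult_right_mono power_mono) (auto simp: d_def distZ_nonneg)
    then have "q (Suc k) = q k"
      using q[of k] q[of "Suc k"] step K(1) by (intro uniq[of _ k]) auto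
    then show ?case using step by simp
  qed simp
  \<comment> \<open>With the constant choice \<open>q K\<close> discarded there is still an
    approximant at some k \<ge> K, against uniqueness.\<close>
  have "\<forall>\<^sub>F k in sequentially. \<exists>r. r \<notin> {q K} \<and> isupnorm r \<le> k \<and>
      real k ^ CARD('n) * d r ^ CARD('m) < b"
    unfolding d_def using Om \<open>0 < b\<close> by (intro Omega_uniform) auto
  then obtain k r where k: "k \<ge> K" and r: "r \<noteq> q K" "isupnorm r \<le> k"
      "real k ^ CARD('n) * d r ^ CARD('m) < b"
    unfolding eventually_sequentially by (metis nat_le_linear singletonI)
  have "r = q k"
    using r q[OF k] by (intro uniq[of _ k]) auto
  then show False using const[OF k] r(1) by simp
qed

subsection \<open>Construction of a shift\<close>

text \<open>Outside \<open>Bad0\<close> the product falls below e at vectors of arbitrarily large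
  norm. Enlarging the distance to the radius \<open>\<delta>'\<close> that makes the product exactly
  e keeps it positive even where the distance is zero, and a large norm forces it below
  \<open>\<delta>\<close>.\<close>

lemma not_Bad0_approx:
  fixes A :: "real^'n^'m"
  assumes "A \<in> unit_mat" "A \<notin> Bad0" "0 < e" "0 < \<delta>"
  obtains q \<delta>' where "N < isupnorm q" "0 < \<delta>'" "\<delta>' \<le> \<delta>" "distZ (A *v ivec q) < \<delta>'"
    "real (isupnorm q) ^ CARD('n) * \<delta>' ^ CARD('m) = e"
proof -
  define f where "f q = real (isupnorm q) ^ CARD('n) * distZ (A *v ivec q) ^ CARD('m)" for q
  have "\<not> 0 < Liminf cofinite (\<lambda>q. ereal (f q))"
    using assms(1,2) by (simp add: Bad0_def f_def)
  then have "\<not> ereal e \<le> Liminf cofinite (\<lambda>q. ereal (f q))"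
    using \<open>0 < e\<close> by (metis ereal_less(2) less_le_trans)
  then have "\<not> (\<forall>\<^sub>F q in cofinite. ereal e \<le> ereal (f q))"
    using Liminf_bounded[of "ereal e" "\<lambda>q. ereal (f q)" cofinite] by (rule contrapos_nn)
  then have inf: "infinite {q. f q < e}"
    unfolding eventually_cofinite ereal_less_eq not_le .
  obtain M :: nat where M: "max 1 (e / \<delta> ^ CARD('m)) < M"
    using reals_Archimedean2 by blast
  obtain q where q: "f q < e" "max N M < isupnorm q"
    using infinite_isupnorm_gt[OF inf] by (metis mem_Collect_eq)
  define u where "u = real (isupnorm q) ^ CARD('n)"
  have u: "real (isupnorm q) \<le> u" "0 < u"
    unfolding u_def using q(2) M self_le_power[of "real (isupnorm q)" "CARD('n)"] by auto
  define \<delta>' where "\<delta>' = root CARD('m) (e / u)"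
  have pow: "\<delta>' ^ CARD('m) = e / u" "0 < \<delta>'"
    unfolding \<delta>'_def using u(2) \<open>0 < e\<close> by (auto simp: real_root_pow_pos2)
  show thesis
  proof
    show "N < isupnorm q" "0 < \<delta>'" using q pow by auto
    show "real (isupnorm q) ^ CARD('n) * \<delta>' ^ CARD('m) = e"
      using pow u by (simp flip: u_def)
    have "e / \<delta> ^ CARD('m) < u" using M q(2) u(1) by linarith
    then have "e / u < \<delta> ^ CARD('m)" using u(2) \<open>0 < \<delta>\<close> by (simp add: field_simps)
    then have "\<delta>' ^ CARD('m) < \<delta> ^ CARD('m)" by (simp only: pow(1))
    then show "\<delta>' \<le> \<delta>" using \<open>0 < \<delta>\<close> by (meson less_imp_le power_less_imp_less_base)
    have "distZ (A *v ivec q) ^ CARD('m) < \<delta>' ^ CARD('m)"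
    proof -
      have "u * distZ (A *v ivec q) ^ CARD('m) < u * \<delta>' ^ CARD('m)"
        using q(1) pow(1) u(2) by (simp add: f_def u_def)
      then show ?thesis using u(2) by (simp only: mult_less_cancel_left_pos)
    qed
    then show "distZ (A *v ivec q) < \<delta>'"
      using pow(2) by (meson less_imp_le power_less_imp_less_base)
  qed
qed

text \<open>The partial sums \<open>Q\<^sub>i\<close> of the \<open>q\<^sub>j\<close> approximate \<open>\<gamma>\<close> to within \<open>2 \<delta>\<^sub>i\<^sub>+\<^sub>1\<close>, where
  \<open>\<parallel>q\<^sub>j\<parallel>\<^sup>n \<delta>\<^sub>j\<^sup>m = 2\<^sup>-\<^sup>j\<close>: if \<open>\<psi>\<close> had only finitely many solutions among the \<open>Q\<^sub>i\<close>, its block sums between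
  consecutive norms would be dominated by a geometric series.\<close>
lemma not_Bad0_Omega:
  fixes A :: "real^'n^'m"
  assumes A: "A \<in> unit_mat" "A \<notin> Bad0"
  obtains \<gamma> where "(A, \<gamma>) \<in> Omega"
proof -
  define P where "P j = (\<lambda>(q :: int^'n, \<delta>). 1 \<le> isupnorm q \<and> 0 < \<delta> \<and> distZ (A *v ivec q) < \<delta> \<and>
      real (isupnorm q) ^ CARD('n) * \<delta> ^ CARD('m) = (1/2) ^ j)" for j :: nat
  \<comment> \<open>The factor 4 keeps the norms of the partial sums at most twice that of their
    last term and strictly increasing. Halving \<open>\<delta>\<close> makes the tails
    geometric.\<close>
  define R where "R = (\<lambda>(q :: int^'n, \<delta>::real) (q' :: int^'n, \<delta>'::real).
      4 * isupnorm q < isupnorm q' \<and> \<delta>' \<le> \<delta> / 2)"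
  have "\<exists>f. \<forall>j. P j (f j) \<and> R (f j) (f (Suc j))"
  proof (rule dependent_nat_choice)
    show "\<exists>x. P 0 x"
    proof -
      obtain q \<delta> where "0 < isupnorm q" "0 < \<delta>" "distZ (A *v ivec q) < \<delta>"
          "real (isupnorm q) ^ CARD('n) * \<delta> ^ CARD('m) = 1"
        using not_Bad0_approx[OF A, of 1 1 0] by (metis zero_less_one)
      then have "P 0 (q, \<delta>)" by (simp add: P_def)
      then show ?thesis by blast
    qed
    show "\<exists>y. P (Suc j) y \<and> R x y" if "P j x" for x j
    proof -
      obtain q \<delta> where x: "x = (q, \<delta>)" by force
      have "0 < \<delta> / 2" using that by (simp add: P_def x)
      then obtain q' \<delta>' where "4 * isupnorm q < isupnorm q'" "0 < \<delta>'" "\<delta>' \<le> \<delta> / 2"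
          "distZ (A *v ivec q') < \<delta>'"
          "real (isupnorm q') ^ CARD('n) * \<delta>' ^ CARD('m) = (1/2) ^ Suc j"
        using not_Bad0_approx[OF A, of "(1/2) ^ Suc j" "\<delta> / 2" "4 * isupnorm q"]
        by (metis half_gt_zero zero_less_one zero_less_power)
      then have "P (Suc j) (q', \<delta>') \<and> R x (q', \<delta>')" by (simp add: P_def R_def x)
      then show ?thesis by blast
    qed
  qed
  then obtain f where f: "\<And>j. P j (f j)" "\<And>j. R (f j) (f (Suc j))" by blast
  define q where "q j = fst (f j)" for j
  define \<delta> where "\<delta> j = snd (f j)" for j
  have q1: "1 \<le> isupnorm (q j)" and \<delta>0: "0 < \<delta> j" and dq: "distZ (A *v ivec (q j)) < \<delta> j"
    and vol: "real (isupnorm (q j)) ^ CARD('n) * \<delta> j ^ CARD('m) = (1/2) ^ j" for j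
    using f(1)[of j] by (auto simp: P_def q_def \<delta>_def split: prod.splits)
  have q4: "4 * isupnorm (q j) < isupnorm (q (Suc j))" and \<delta>2: "\<delta> (Suc j) \<le> \<delta> j / 2" for j
    using f(2)[of j] by (auto simp: R_def q_def \<delta>_def split: prod.splits)
  have \<delta>_geo: "\<delta> (i + j) \<le> \<delta> i * (1/2) ^ j" for i j
  proof (induction j)
    case (Suc j)
    then show ?case using \<delta>2[of "i + j"] by simp
  qed simp

  have "\<exists>p :: int^'m. \<forall>i. \<bar>(A *v ivec (q j)) $ i - of_int (p $ i)\<bar> < \<delta> j" for j
    using dq[of j] by (simp add: distZ_less_iff)
  then obtain p :: "nat \<Rightarrow> int^'m" where
    p: "\<And>j i. \<bar>(A *v ivec (q j)) $ i - of_int (p j $ i)\<bar> < \<delta> j" by metis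
  \<comment> \<open>\<open>e j\<close> is the signed residue of A q_j modulo the integers. The
    residues sum absolutely, and \<open>\<gamma>\<close> is the sum reduced into the unit
    cube.\<close>
  define e where "e j i = (A *v ivec (q j)) $ i - of_int (p j $ i)" for j i
  have e_le: "\<bar>e (i + j) l\<bar> \<le> \<delta> i * (1/2) ^ j" for i j l
    using p[of "i + j" l] \<delta>_geo[of i j] by (simp add: e_def)
  have geo: "(\<lambda>j. \<delta> i * (1/2) ^ j) sums (\<delta> i * 2)" for i
    using sums_mult[OF geometric_sums[of "1/2 :: real"], of "\<delta> i"] by simp
  have sme: "summable (\<lambda>j. e (i + j) l)" for i l
    using e_le by (intro summable_comparison_test'[OF sums_summable[OF geo[of i]]]) auto
  have sm0: "summable (\<lambda>j. e j l)" for l using sme[of 0] by simp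
  define t where "t l = (\<Sum>j. e j l)" for l
  define \<gamma> :: "real^'m" where "\<gamma> = (\<chi> l. frac (t l))"
  define Q where "Q i = (\<Sum>j\<le>i. q j)" for i
  have dQ: "distZ (A *v ivec (Q i) - \<gamma>) \<le> 2 * \<delta> (Suc i)" for i
  proof (rule distZ_le)
    fix l
    \<comment> \<open>This lattice point absorbs the integer parts of the first terms and of
      \<open>t\<close>, leaving only the tail of the residues from \<open>Suc i\<close> on.\<close>
    let ?p = "(\<chi> l. (\<Sum>j\<le>i. p j $ l) + \<lfloor>t l\<rfloor>) :: int^'m"
    have "t l = (\<Sum>j. e (j + Suc i) l) + (\<Sum>j<Suc i. e j l)"
      unfolding t_def using sm0 by (rule suminf_split_initial_segment)
    moreover have "(\<Sum>j<Suc i. e j l) = (A *v ivec (Q i)) $ l - (\<Sum>j\<le>i. of_int (p j $ l))"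
      by (simp add: e_def Q_def ivec_sum lessThan_Suc_atMost sum_subtractf
          linear_sum[OF matrix_vector_mul_linear])
    ultimately have "(A *v ivec (Q i) - \<gamma>) $ l - of_int (?p $ l) = - (\<Sum>j. e (Suc i + j) l)"
      by (simp add: \<gamma>_def frac_def add.commute)
    moreover have "\<bar>\<Sum>j. e (Suc i + j) l\<bar> \<le> \<delta> (Suc i) * 2"
      using summable_norm_comparison_test[of "\<lambda>j. e (Suc i + j) l" "\<lambda>j. \<delta> (Suc i) * (1/2) ^ j"]
        suminf_le[of "\<lambda>j. \<bar>e (Suc i + j) l\<bar>" "\<lambda>j. \<delta> (Suc i) * (1/2) ^ j"]
        summable_rabs[of "\<lambda>j. e (Suc i + j) l"] e_le[of "Suc i" _ l] geo[of "Suc i"]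
      by (force simp: sums_iff)
    ultimately show "\<bar>(A *v ivec (Q i) - \<gamma>) $ l - of_int (?p $ l)\<bar> \<le> 2 * \<delta> (Suc i)" by simp
  qed

  have Q_le: "isupnorm (Q i) \<le> 2 * isupnorm (q i)" for i
  proof (induction i)
    case (Suc i)
    have "isupnorm (Q (Suc i)) \<le> isupnorm (Q i) + isupnorm (q (Suc i))"
      using isupnorm_add_le[of "Q i" "q (Suc i)"] by (simp add: Q_def)
    then show ?case using Suc q4[of i] by linarith
  qed (simp add: Q_def)
  have Q_Suc: "isupnorm (Q i) < isupnorm (Q (Suc i))" for i
  proof -
    have "q (Suc i) = Q (Suc i) - Q i" by (simp add: Q_def)
    then have "isupnorm (q (Suc i)) \<le> isupnorm (Q (Suc i)) + isupnorm (Q i)"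
      using isupnorm_diff_le by metis
    then show ?thesis using Q_le[of i] q4[of i] by linarith
  qed
  have Q_pos: "1 \<le> isupnorm (Q i)" for i
    by (cases i) (use q1[of 0] Q_Suc in \<open>auto simp: Q_def Suc_le_eq intro: le_less_trans\<close>)
  \<comment> \<open>Injectivity turns infinitely many good indices into infinitely many good
    vectors.\<close>
  have inj_Q: "inj Q"
    using strict_mono_Suc_iff[of "\<lambda>i. isupnorm (Q i)"] Q_Suc
    by (metis (mono_tags, lifting) injI strict_mono_eq)

  have "(A, \<gamma>) \<in> W \<psi>" if \<psi>: "\<psi> \<in> DD TYPE('m) TYPE('n)" for \<psi>
  proof -
    have nonneg: "0 \<le> \<psi> k" if "1 \<le> k" for k using \<psi> that by (simp add: DD_def)
    have dec: "\<psi> b \<le> \<psi> a" if "1 \<le> a" "a \<le> b" for a b using \<psi> that by (simp add: DD_def)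
    define g where "g k = real (Suc k) ^ (CARD('n) - 1) * \<psi> (Suc k) ^ CARD('m)" for k
    have g0: "0 \<le> g k" for k by (simp add: g_def nonneg)
    \<comment> \<open>\<open>r i\<close> bounds the norm of \<open>Q i\<close>, so beyond
      \<open>r i\<close> monotonicity bounds \<open>\<psi>\<close> by its value there, which is at
      most 2 \<open>\<delta> (Suc i)\<close> whenever \<open>Q i\<close> is not a solution.\<close>
    define r where "r i = 2 * isupnorm (q i)" for i
    have r_less: "r i < r (Suc i)" for i using q4[of i] by (simp add: r_def)
    have r_ge: "i \<le> r i" for i
      using strict_mono_Suc_iff[of r] r_less by (simp add: strict_mono_imp_increasing)
    have "infinite {i. distZ (A *v ivec (Q i) - \<gamma>) < \<psi> (isupnorm (Q i))}"
    proof
      assume "finite {i. distZ (A *v ivec (Q i) - \<gamma>) < \<psi> (isupnorm (Q i))}"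
      then obtain i0 where i0: "\<And>i. i0 \<le> i \<Longrightarrow> \<psi> (isupnorm (Q i)) \<le> distZ (A *v ivec (Q i) - \<gamma>)"
        by (metis (mono_tags, lifting) finite_nat_set_iff_bounded_le mem_Collect_eq not_less
            not_less_eq_eq)
      \<comment> \<open>One factor 2^n comes from r = 2 \<open>isupnorm (q i)\<close>, the other 2^m
        from the radius 2 \<open>\<delta>\<close>.\<close>
      let ?C = "2 ^ CARD('n) * 2 ^ CARD('m) :: real"
      have block: "sum g {r i..<r (Suc i)} \<le> ?C * (1/2) ^ Suc i" if "i0 \<le> i" for i
      proof -
        have \<psi>_le: "\<psi> (Suc k) \<le> 2 * \<delta> (Suc i)" if "r i \<le> k" for k
          using dec[of "isupnorm (Q i)" "Suc k"] Q_le[of i] Q_pos[of i] that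
            i0[OF \<open>i0 \<le> i\<close>] dQ[of i] by (simp add: r_def)
        have "sum g {r i..<r (Suc i)}
            \<le> (\<Sum>k\<in>{r i..<r (Suc i)}. real (r (Suc i)) ^ (CARD('n) - 1) * (2 * \<delta> (Suc i)) ^ CARD('m))"
          unfolding g_def by (intro sum_mono mult_mono power_mono \<psi>_le) (auto simp: nonneg)
        also have "\<dots> \<le> real (r (Suc i)) * (real (r (Suc i)) ^ (CARD('n) - 1) * (2 * \<delta> (Suc i)) ^ CARD('m))"
          using \<delta>0[of "Suc i"] by (simp add: mult_right_mono)
        also have "\<dots> = real (r (Suc i)) ^ CARD('n) * (2 * \<delta> (Suc i)) ^ CARD('m)"
          by (simp add: power_eq_if)
        also have "\<dots> = ?C * (1/2) ^ Suc i"
          by (simp only: r_def of_nat_mult of_nat_numeral power_mult_distrib vol[symmetric]) simp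
        finally show ?thesis .
      qed
      \<comment> \<open>The form 1 - 2^(-i) makes the induction close exactly: adding 2^(-i-1) gives
        the next value.\<close>
      have bound: "sum g {r i0..<r i} \<le> ?C * (1 - (1/2) ^ i)" if "i0 \<le> i" for i
        using that
      proof (induction i rule: dec_induct)
        case base
        show ?case by (simp add: power_le_one)
      next
        case (step i)
        have "r i0 \<le> r i"
          using lift_Suc_mono_le[of r] r_less step(1) by (simp add: less_imp_le)
        then have "sum g {r i0..<r (Suc i)} = sum g {r i0..<r i} + sum g {r i..<r (Suc i)}"
          using r_less[of i] by (simp add: sum.atLeastLessThan_concat)
        also have "\<dots> \<le> ?C * (1 - (1/2) ^ i) + ?C * (1/2) ^ Suc i"
          using step block[of i] by (intro add_mono) auto
        also have "\<dots> = ?C * (1 - (1/2) ^ Suc i)" by (simp add: algebra_simps)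
        finally show ?case .
      qed
      have "summable g"
      proof (rule summableI_nonneg_bounded)
        fix N
        let ?i = "max i0 N"
        have "sum g {..<N} \<le> sum g ({..<r i0} \<union> {r i0..<r ?i})"
          using r_ge[of ?i] g0 by (intro sum_mono2) auto
        also have "\<dots> \<le> sum g {..<r i0} + sum g {r i0..<r ?i}"
          by (subst sum.union_disjoint) auto
        also have "\<dots> \<le> sum g {..<r i0} + ?C * (1 - (1/2) ^ ?i)"
          using bound[of ?i] by simp
        also have "\<dots> \<le> sum g {..<r i0} + ?C * 1"
          by (intro add_left_mono mult_left_mono) auto
        finally show "sum g {..<N} \<le> sum g {..<r i0} + ?C * 1" .
      qed (rule g0)
      then show False using \<psi> by (simp add: DD_def g_def[abs_def])
    qed
    then have "infinite (Q ` {i. distZ (A *v ivec (Q i) - \<gamma>) < \<psi> (isupnorm (Q i))})"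
      using inj_Q finite_imageD inj_on_subset by blast
    then have "infinite {q. distZ (A *v ivec q - \<gamma>) < \<psi> (isupnorm q)}"
      by (rule infinite_super[rotated]) auto
    moreover have "\<gamma> \<in> unit_cube"
      by (simp add: \<gamma>_def unit_cube_def frac_lt_1)
    ultimately show ?thesis using A(1) by (simp add: W_def)
  qed
  then show thesis by (intro that) (auto simp: Omega_def)
qed

subsection \<open>Measure estimates\<close>

lemma emeasure_lborel_cbox_cart:
  fixes a b :: "real^'k"
  assumes "\<And>i. a $ i \<le> b $ i"
  shows "emeasure lborel (cbox a b) = ennreal (\<Prod>i\<in>UNIV. b $ i - a $ i)"
proof -
  have "emeasure lborel (cbox a b) = ennreal (measure lborel (cbox a b))"
    using emeasure_lborel_cbox_finite[of a b] by (intro emeasure_eq_ennreal_measure) simp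
  also have "measure lborel (cbox a b) = (\<Prod>i\<in>UNIV. b $ i - a $ i)"
    using assms by (subst content_cbox_cart) (auto simp: cbox_interval less_eq_vec_def)
  finally show ?thesis .
qed

text \<open>The set is covered by at most (5|s|)^m cubes of side 2 \<open>\<delta>\<close> / |s|, so
  |s| cancels and the bound is uniform in \<open>s\<close>.\<close>

lemma emeasure_distZ_less:
  fixes v :: "real^'m" and s :: real
  assumes s: "1 \<le> \<bar>s\<bar>" and \<delta>: "0 < \<delta>" "\<delta> \<le> 1"
  obtains T where "T \<in> sets lborel" "{t \<in> cbox 0 1. distZ (v - s *\<^sub>R t) < \<delta>} \<subseteq> T"
    "emeasure lborel T \<le> ennreal ((10 * \<delta>) ^ CARD('m))"
proof -
  \<comment> \<open>Each coordinate of s t is at most |s| in absolute value and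
    \<open>\<delta>\<close> \<le> 1, so only integers within |s| + 1 of v_i matter. There are at
    most 2|s| + 3 \<le> 5|s| of them.\<close>
  define S where "S i = {\<lceil>v $ i - \<bar>s\<bar> - 1\<rceil>..\<lfloor>v $ i + \<bar>s\<bar> + 1\<rfloor>}" for i
  define P where "P = {p :: int^'m. \<forall>i. p $ i \<in> S i}"
  define B where "B p = cbox ((\<chi> i. (v $ i - of_int (p $ i)) / s - \<delta> / \<bar>s\<bar>) :: real^'m)
      (\<chi> i. (v $ i - of_int (p $ i)) / s + \<delta> / \<bar>s\<bar>)" for p :: "int^'m"
  have finP: "finite P" unfolding P_def by (rule int_vec_box) (simp add: S_def)
  have card_S: "real (card (S i)) \<le> 5 * \<bar>s\<bar>" for i
  proof -
    have "real_of_int (\<lfloor>v $ i + \<bar>s\<bar> + 1\<rfloor> - \<lceil>v $ i - \<bar>s\<bar> - 1\<rceil> + 1) \<le> 5 * \<bar>s\<bar>"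
      using of_int_floor_le[of "v $ i + \<bar>s\<bar> + 1"] le_of_int_ceiling[of "v $ i - \<bar>s\<bar> - 1"] s
      unfolding of_int_add of_int_diff of_int_1 by linarith
    then show ?thesis using s by (simp add: S_def)
  qed
  have "real (card P) = (\<Prod>i\<in>UNIV. real (card (S i)))"
    unfolding P_def by (subst int_vec_box) (simp_all add: S_def)
  also have "\<dots> \<le> (\<Prod>i\<in>(UNIV :: 'm set). 5 * \<bar>s\<bar>)"
    by (intro prod_mono) (simp add: card_S)
  finally have card_P: "real (card P) \<le> (5 * \<bar>s\<bar>) ^ CARD('m)" by simp
  have meas_B: "emeasure lborel (B p) = ennreal ((2 * \<delta> / \<bar>s\<bar>) ^ CARD('m))" for p
    unfolding B_def using \<delta> by (subst emeasure_lborel_cbox_cart) auto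
  show thesis
  proof
    show "(\<Union>p\<in>P. B p) \<in> sets lborel"
      using finP by (intro sets.finite_UN) (auto simp: B_def)
    have "emeasure lborel (\<Union>p\<in>P. B p) \<le> (\<Sum>p\<in>P. emeasure lborel (B p))"
      using finP by (intro emeasure_subadditive_finite) (auto simp: B_def)
    also have "\<dots> = ennreal (real (card P) * (2 * \<delta> / \<bar>s\<bar>) ^ CARD('m))"
      using \<delta> by (simp add: meas_B ennreal_mult' ennreal_of_nat_eq_real_of_nat)
    also have "\<dots> \<le> ennreal ((5 * \<bar>s\<bar>) ^ CARD('m) * (2 * \<delta> / \<bar>s\<bar>) ^ CARD('m))"
      using card_P \<delta> by (intro ennreal_leI mult_right_mono) auto
    also have "(5 * \<bar>s\<bar>) ^ CARD('m) * (2 * \<delta> / \<bar>s\<bar>) ^ CARD('m) = (10 * \<delta>) ^ CARD('m)"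
    proof -
      have "5 * \<bar>s\<bar> * (2 * \<delta> / \<bar>s\<bar>) = 10 * \<delta>" using s by simp
      then show ?thesis by (metis power_mult_distrib)
    qed
    finally show "emeasure lborel (\<Union>p\<in>P. B p) \<le> ennreal ((10 * \<delta>) ^ CARD('m))" .
    show "{t \<in> cbox 0 1. distZ (v - s *\<^sub>R t) < \<delta>} \<subseteq> (\<Union>p\<in>P. B p)"
    proof
      fix t assume "t \<in> {t \<in> cbox 0 1. distZ (v - s *\<^sub>R t) < \<delta>}"
      then have t: "\<And>i. 0 \<le> t $ i" "\<And>i. t $ i \<le> 1" and "distZ (v - s *\<^sub>R t) < \<delta>"
        by (auto simp: mem_box_cart)
      then obtain p :: "int^'m" where p: "\<And>i. \<bar>v $ i - s * t $ i - of_int (p $ i)\<bar> < \<delta>"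
        by (auto simp: distZ_less_iff)
      have "p $ i \<in> S i" for i
      proof -
        have "\<bar>s * t $ i\<bar> \<le> \<bar>s\<bar>"
          using t[of i] by (simp add: abs_mult mult_left_le)
        then show ?thesis
          using p[of i] \<delta> unfolding S_def atLeastAtMost_iff ceiling_le_iff le_floor_iff
          by (simp add: abs_if split: if_splits)
      qed
      moreover have "t \<in> B p"
      proof -
        have "\<bar>(v $ i - of_int (p $ i)) / s - t $ i\<bar> \<le> \<delta> / \<bar>s\<bar>" for i
        proof -
          have "(v $ i - of_int (p $ i)) / s - t $ i = (v $ i - s * t $ i - of_int (p $ i)) / s"
            using s by (auto simp: field_simps)
          then have "\<bar>(v $ i - of_int (p $ i)) / s - t $ i\<bar> = \<bar>v $ i - s * t $ i - of_int (p $ i)\<bar> / \<bar>s\<bar>"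
            by (simp only: abs_divide)
          also have "\<dots> \<le> \<delta> / \<bar>s\<bar>" using p[of i] by (intro divide_right_mono) auto
          finally show ?thesis .
        qed
        then show ?thesis by (simp add: B_def mem_box_cart abs_le_iff algebra_simps)
      qed
      ultimately show "t \<in> (\<Union>p\<in>P. B p)" by (auto simp: P_def)
    qed
  qed
qed

lemma emeasure_distZ_shift_less:
  fixes v :: "real^'m"
  assumes "0 < \<delta>" "\<delta> \<le> 1"
  obtains T where "T \<in> sets lborel" "{\<gamma> \<in> unit_cube. distZ (v - \<gamma>) < \<delta>} \<subseteq> T"
    "emeasure lborel T \<le> ennreal ((10 * \<delta>) ^ CARD('m))"
proof -
  obtain T where T: "T \<in> sets lborel" "{t \<in> cbox 0 1. distZ (v - 1 *\<^sub>R t) < \<delta>} \<subseteq> T"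
    "emeasure lborel T \<le> ennreal ((10 * \<delta>) ^ CARD('m))"
    using emeasure_distZ_less[of 1 \<delta> v] assms by auto
  moreover have "{\<gamma> \<in> unit_cube. distZ (v - \<gamma>) < \<delta>} \<subseteq> {t \<in> cbox 0 1. distZ (v - 1 *\<^sub>R t) < \<delta>}"
    by (auto simp: unit_cube_def mem_box_cart less_imp_le)
  ultimately show thesis using that by blast
qed

lemma open_distZ_less:
  fixes f :: "'a::topological_space \<Rightarrow> real^'k"
  assumes "continuous_on UNIV f"
  shows "open {x. distZ (f x) < d}"
proof -
  have "open (\<Inter>i. {x. \<bar>f x $ i - of_int (p $ i)\<bar> < d})" for p :: "int^'k"
    using assms by (intro open_INT ballI open_Collect_less continuous_intros) auto
  then have "open (\<Union>p :: int^'k. \<Inter>i. {x. \<bar>f x $ i - of_int (p $ i)\<bar> < d})"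
    by (intro open_UN) blast
  moreover have "{x. distZ (f x) < d} = (\<Union>p :: int^'k. \<Inter>i. {x. \<bar>f x $ i - of_int (p $ i)\<bar> < d})"
    by (auto simp: distZ_less_iff)
  ultimately show ?thesis by simp
qed

text \<open>Averaging over translations \<open>t\<close> of column \<open>j\<close> reduces to the one-vector estimate: for fixed \<open>A\<close>
  the translation changes \<open>A q\<close> by \<open>q\<^sub>j t\<close>.\<close>
lemma emeasure_distZ_matrix_less:
  fixes q :: "int^'n" and \<gamma> :: "real^'m"
  assumes "q \<noteq> 0" and \<delta>: "0 < \<delta>" "\<delta> \<le> 1"
  obtains T where "T \<in> sets lborel"
    "{A \<in> (unit_mat :: (real^'n^'m) set). distZ (A *v ivec q - \<gamma>) < \<delta>} \<subseteq> T"
    "emeasure lborel T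
      \<le> emeasure lborel (cbox (\<chi> i j. -1) (\<chi> i j. 1) :: (real^'n^'m) set) * ennreal ((10 * \<delta>) ^ CARD('m))"
proof -
  obtain j where "q $ j \<noteq> 0" using assms(1) by (auto simp: vec_eq_iff)
  \<comment> \<open>The minus sign matches the form v - s t of the one-vector estimate, since
    shifting column j by t adds q_j t.\<close>
  then have s: "1 \<le> \<bar>- real_of_int (q $ j)\<bar>" by linarith
  define h :: "real^'m \<Rightarrow> real^'n^'m" where "h t = (\<chi> i l. if l = j then t $ i else 0)" for t
  have h_mult: "h t *v ivec q = real_of_int (q $ j) *\<^sub>R t" for t
    by (simp add: vec_eq_iff matrix_vector_mult_def h_def if_distrib[of "\<lambda>x. x * _"] cong: if_cong)
  have "continuous_on UNIV (\<lambda>t :: real^'m. if l = j then t $ i else 0)" for i and l :: 'n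
    by (cases "l = j") (auto intro: continuous_intros)
  then have "continuous_on UNIV h"
    unfolding h_def by (intro continuous_on_vec_lambda)
  then have [measurable]: "h \<in> borel_measurable borel"
    by (rule borel_measurable_continuous_onI)
  let ?I = "cbox 0 1 :: (real^'m) set"
  \<comment> \<open>This box contains every matrix that a column shift by a vector of the unit cube
    moves into the closed unit box.\<close>
  let ?U = "cbox (\<chi> i j. -1) (\<chi> i j. 1) :: (real^'n^'m) set"
  define G where "G = cbox 0 (\<chi> i j. 1) \<inter> {A :: real^'n^'m. distZ (A *v ivec q - \<gamma>) < \<delta>}"
  have "open {A :: real^'n^'m. distZ (A *v ivec q - \<gamma>) < \<delta>}"
    unfolding matrix_vector_mult_def
    by (intro open_distZ_less continuous_intros continuous_on_vec_lambda)
  then have G [measurable]: "G \<in> sets borel" by (simp add: G_def)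
  have inner: "(\<integral>\<^sup>+t. indicator ?I t * indicator G (h t + A) \<partial>lborel)
      \<le> indicator ?U A * ennreal ((10 * \<delta>) ^ CARD('m))" for A
  proof -
    let ?v = "A *v ivec q - \<gamma>"
    obtain T where T: "T \<in> sets lborel"
      "{t \<in> ?I. distZ (?v - (- real_of_int (q $ j)) *\<^sub>R t) < \<delta>} \<subseteq> T"
      "emeasure lborel T \<le> ennreal ((10 * \<delta>) ^ CARD('m))"
      using emeasure_distZ_less[OF s \<delta>] by blast
    have "A \<in> ?U \<and> t \<in> T" if t: "t \<in> ?I" "h t + A \<in> G" for t
    proof
      have h01: "0 \<le> h t $ i $ l \<and> h t $ i $ l \<le> 1" for i l
        using t(1) by (auto simp: h_def mem_box_cart)
      have hA: "0 \<le> h t $ i $ l + A $ i $ l \<and> h t $ i $ l + A $ i $ l \<le> 1" for i l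
        using t(2) by (auto simp: G_def cbox_interval less_eq_vec_def)
      have "-1 \<le> A $ i $ l \<and> A $ i $ l \<le> 1" for i l
        using h01[of i l] hA[of i l] by linarith
      then show "A \<in> ?U"
        by (simp add: cbox_interval less_eq_vec_def)
      have "(h t + A) *v ivec q - \<gamma> = ?v - (- real_of_int (q $ j)) *\<^sub>R t"
        by (simp add: matrix_vector_mult_add_rdistrib h_mult)
      moreover have "distZ ((h t + A) *v ivec q - \<gamma>) < \<delta>" using t(2) by (simp add: G_def)
      ultimately have "distZ (?v - (- real_of_int (q $ j)) *\<^sub>R t) < \<delta>" by (simp only:)
      then show "t \<in> T" using t(1) T(2) by blast
    qed
    then have "(\<integral>\<^sup>+t. indicator ?I t * indicator G (h t + A) \<partial>lborel)
        \<le> (\<integral>\<^sup>+t. indicator ?U A * indicator T t \<partial>lborel)"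
      by (intro nn_integral_mono) (auto simp: indicator_def)
    also have "\<dots> = indicator ?U A * emeasure lborel T"
      using T(1) by (simp add: nn_integral_cmult)
    also have "\<dots> \<le> indicator ?U A * ennreal ((10 * \<delta>) ^ CARD('m))"
      using T(3) by (rule mult_left_mono) simp
    finally show ?thesis .
  qed
  have transl: "(\<integral>\<^sup>+A. indicator G (h t + A) \<partial>lborel) = emeasure lborel G" for t
  proof -
    have "emeasure lborel G = (\<integral>\<^sup>+A. indicator G A \<partial>distr lborel borel ((+) (h t)))"
      by (simp add: lborel_distr_plus)
    also have "\<dots> = (\<integral>\<^sup>+A. indicator G (h t + A) \<partial>lborel)"
      by (rule nn_integral_distr) auto
    finally show ?thesis by simp
  qed
  \<comment> \<open>The cube of shifts has measure 1, so averaging over it leaves the measure of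
    \<open>G\<close> unchanged. Translation invariance and Fubini then bring in the bound for a
    fixed matrix.\<close>
  have "emeasure lborel ?I = 1" by (subst emeasure_lborel_cbox_cart) auto
  then have "emeasure lborel G = (\<integral>\<^sup>+t. indicator ?I t * emeasure lborel G \<partial>lborel)"
    by (subst nn_integral_multc) auto
  also have "\<dots> = (\<integral>\<^sup>+t. (\<integral>\<^sup>+A. indicator ?I t * indicator G (h t + A) \<partial>lborel) \<partial>lborel)"
    by (subst nn_integral_cmult) (auto simp: transl)
  also have "\<dots> = (\<integral>\<^sup>+A. (\<integral>\<^sup>+t. indicator ?I t * indicator G (h t + A) \<partial>lborel) \<partial>lborel)"
    by (rule lborel_pair.Fubini') measurable
  also have "\<dots> \<le> (\<integral>\<^sup>+A. indicator ?U A * ennreal ((10 * \<delta>) ^ CARD('m)) \<partial>lborel)"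
    by (rule nn_integral_mono) (rule inner)
  also have "\<dots> = emeasure lborel ?U * ennreal ((10 * \<delta>) ^ CARD('m))"
    by (subst nn_integral_multc) auto
  finally have "emeasure lborel G \<le> emeasure lborel ?U * ennreal ((10 * \<delta>) ^ CARD('m))" .
  moreover have "{A \<in> unit_mat. distZ (A *v ivec q - \<gamma>) < \<delta>} \<subseteq> G"
    by (auto simp: G_def unit_mat_def cbox_interval less_eq_vec_def less_imp_le)
  ultimately show thesis using that[of G] G by simp
qed

text \<open>The exceptional set of level \<open>k\<close> has measure at most \<open>3\<^sup>n K c\<close> uniformly in \<open>k\<close>, so the
  set of points lying in all but finitely many of them is at most that large, for every \<open>c\<close>.\<close>
lemma null_sets_uniform_approx:
  fixes d :: "int^'n \<Rightarrow> 'a::euclidean_space \<Rightarrow> real"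
  assumes "0 \<le> K" "0 < m"
    and cover: "\<And>q \<delta>. q \<noteq> 0 \<Longrightarrow> 0 < \<delta> \<Longrightarrow> \<delta> \<le> 1 \<Longrightarrow>
      \<exists>T\<in>sets lborel. {x \<in> S. d q x < \<delta>} \<subseteq> T \<and> emeasure lborel T \<le> ennreal (K * \<delta> ^ m)"
    and "Z \<subseteq> S"
    and unif: "\<And>x c. x \<in> Z \<Longrightarrow> 0 < c \<Longrightarrow> \<forall>\<^sub>F k in sequentially.
      \<exists>q. q \<noteq> 0 \<and> isupnorm q \<le> k \<and> real k ^ CARD('n) * d q x ^ m < c"
  shows "Z \<in> null_sets lebesgue"
proof -
  have "\<exists>T. Z \<subseteq> T \<and> T \<in> lmeasurable \<and> measure lebesgue T \<le> e" if "0 < e" for e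
  proof -
    \<comment> \<open>The minimum with 1 ensures radii at most 1, and K + 1 keeps the denominator
      positive when K = 0.\<close>
    define c where "c = min 1 (e / (3 ^ CARD('n) * (K + 1)))"
    have c: "0 < c" "c \<le> 1" "3 ^ CARD('n) * K * c \<le> e"
    proof -
      show "0 < c" "c \<le> 1" using \<open>0 < e\<close> \<open>0 \<le> K\<close> by (auto simp: c_def)
      have "3 ^ CARD('n) * K * c \<le> 3 ^ CARD('n) * (K + 1) * (e / (3 ^ CARD('n) * (K + 1)))"
        using \<open>0 \<le> K\<close> \<open>0 < c\<close> by (intro mult_mono) (auto simp: c_def)
      then show "3 ^ CARD('n) * K * c \<le> e" using \<open>0 \<le> K\<close> by simp
    qed
    \<comment> \<open>The radius equates the condition at level k + 1 with a plain distance bound;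
      the shift by one avoids dividing by zero.\<close>
    define \<delta> where "\<delta> k = root m (c / real (Suc k) ^ CARD('n))" for k
    have \<delta>_pow: "\<delta> k ^ m = c / real (Suc k) ^ CARD('n)" for k
      using c \<open>0 < m\<close> by (simp add: \<delta>_def real_root_pow_pos2)
    have \<delta>: "0 < \<delta> k" "\<delta> k \<le> 1" for k
    proof -
      have "c / real (Suc k) ^ CARD('n) \<le> 1"
      proof -
        have "1 \<le> real (Suc k) ^ CARD('n)" by (rule one_le_power) simp
        then show ?thesis using c(2) by (subst divide_le_eq_1_pos) linarith+
      qed
      then show "0 < \<delta> k" "\<delta> k \<le> 1" using c \<open>0 < m\<close> by (auto simp: \<delta>_def)
    qed
    define B where "B k = {q :: int^'n. isupnorm q \<le> Suc k} - {0}" for k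
    have finB: "finite (B k)" for k unfolding B_def using finite_isupnorm_ball by blast
    have "\<forall>q k. \<exists>T. q \<noteq> 0 \<longrightarrow> T \<in> sets lborel \<and> {x \<in> S. d q x < \<delta> k} \<subseteq> T \<and>
        emeasure lborel T \<le> ennreal (K * \<delta> k ^ m)"
      using cover \<delta> by meson
    then obtain T where T: "\<And>q k. q \<noteq> 0 \<Longrightarrow> T q k \<in> sets lborel"
      "\<And>q k. q \<noteq> 0 \<Longrightarrow> {x \<in> S. d q x < \<delta> k} \<subseteq> T q k"
      "\<And>q k. q \<noteq> 0 \<Longrightarrow> emeasure lborel (T q k) \<le> ennreal (K * \<delta> k ^ m)"
      by metis
    define V where "V k = (\<Union>q\<in>B k. T q k)" for k
    have V_sets [measurable]: "V k \<in> sets lborel" for k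
      unfolding V_def using finB T(1) by (intro sets.finite_UN) (auto simp: B_def)
    have V_le: "emeasure lborel (V k) \<le> ennreal e" for k
    proof -
      have "card (B k) \<le> (2 * Suc k + 1) ^ CARD('n)"
        unfolding B_def card_isupnorm_ball[symmetric] by (intro card_mono finite_isupnorm_ball) auto
      also have "\<dots> \<le> (3 * Suc k) ^ CARD('n)" by (intro power_mono) auto
      finally have "real (card (B k)) \<le> real ((3 * Suc k) ^ CARD('n))" by (rule of_nat_mono)
      then have card: "real (card (B k)) \<le> 3 ^ CARD('n) * real (Suc k) ^ CARD('n)"
        by (simp only: of_nat_power of_nat_mult power_mult_distrib of_nat_numeral)
      have "emeasure lborel (V k) \<le> (\<Sum>q\<in>B k. emeasure lborel (T q k))"
        unfolding V_def using finB T(1) by (intro emeasure_subadditive_finite) (auto simp: B_def)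
      also have "\<dots> \<le> (\<Sum>q\<in>B k. ennreal (K * \<delta> k ^ m))"
        by (intro sum_mono T(3)) (auto simp: B_def)
      also have "\<dots> = ennreal (real (card (B k)) * (K * \<delta> k ^ m))"
        by (simp add: ennreal_mult' ennreal_of_nat_eq_real_of_nat)
      also have "\<dots> \<le> ennreal (3 ^ CARD('n) * real (Suc k) ^ CARD('n) * (K * \<delta> k ^ m))"
        using card \<open>0 \<le> K\<close> \<delta>[of k] by (intro ennreal_leI mult_right_mono) auto
      also have "3 ^ CARD('n) * real (Suc k) ^ CARD('n) * (K * \<delta> k ^ m) = 3 ^ CARD('n) * K * c"
        by (simp add: \<delta>_pow)
      also have "ennreal \<dots> \<le> ennreal e" using c(3) by (rule ennreal_leI)
      finally show ?thesis .
    qed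
    \<comment> \<open>The union of the increasing sets \<open>L N\<close> is the lower limit of the
      \<open>V k\<close>, so continuity from below preserves the bound e.\<close>
    define L where "L N = (\<Inter>k\<in>{N..}. V k)" for N
    have L_sets [measurable]: "L N \<in> sets lborel" for N
      unfolding L_def using V_sets by (intro sets.countable_INT') auto
    have "incseq L" by (auto simp: incseq_def L_def)
    then have "emeasure lborel (\<Union>N. L N) = (SUP N. emeasure lborel (L N))"
      using L_sets by (intro SUP_emeasure_incseq[symmetric]) auto
    also have "\<dots> \<le> ennreal e"
    proof (rule SUP_least)
      show "emeasure lborel (L N) \<le> ennreal e" for N
        using V_sets[of N] by (intro order_trans[OF emeasure_mono V_le[of N]]) (auto simp: L_def)
    qed
    finally have L_le: "emeasure lborel (\<Union>N. L N) \<le> ennreal e" .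
    have UL_sets: "(\<Union>N. L N) \<in> sets lborel"
      using L_sets by (intro sets.countable_UN) auto
    then have L_lebesgue: "emeasure lebesgue (\<Union>N. L N) = emeasure lborel (\<Union>N. L N)"
      by simp
    show ?thesis
    proof (intro exI conjI)
      show "Z \<subseteq> (\<Union>N. L N)"
      proof
        fix x assume "x \<in> Z"
        then obtain N where N: "\<And>k. N \<le> k \<Longrightarrow>
            \<exists>q. q \<noteq> 0 \<and> isupnorm q \<le> k \<and> real k ^ CARD('n) * d q x ^ m < c"
          using unif c(1) unfolding eventually_sequentially by meson
        have "x \<in> V k" if k: "N \<le> k" for k
        proof -
          obtain q where q: "q \<noteq> 0" "isupnorm q \<le> Suc k" "real (Suc k) ^ CARD('n) * d q x ^ m < c"
            using N[OF le_SucI[OF k]] by blast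
          have "d q x ^ m < \<delta> k ^ m" using q(3) unfolding \<delta>_pow
            by (subst pos_less_divide_eq) (auto simp: mult.commute)
          then have "d q x < \<delta> k" using \<delta>[of k] by (meson less_imp_le power_less_imp_less_base)
          then have "x \<in> T q k" using T(2)[OF q(1)] \<open>x \<in> Z\<close> \<open>Z \<subseteq> S\<close> by blast
          then show ?thesis using q by (auto simp: V_def B_def)
        qed
        then show "x \<in> (\<Union>N. L N)" by (auto simp: L_def)
      qed
      have "(\<Union>N. L N) \<in> sets lebesgue" using UL_sets by simp
      then show "(\<Union>N. L N) \<in> lmeasurable"
        using L_le L_lebesgue by (intro fmeasurableI) (auto simp: le_less_trans)
      show "measure lebesgue (\<Union>N. L N) \<le> e"
        unfolding measure_def L_lebesgue using L_le \<open>0 < e\<close> by (simp add: enn2real_leI)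
    qed
  qed
  then show ?thesis
    unfolding negligible_iff_null_sets[symmetric] by (simp add: negligible_outer_le)
qed

section \<open>The sections of \<open>Omega\<close> are null\<close>

lemma null_sets_Omega_A:
  "Omega_A (A :: real^'n^'m) \<in> null_sets lebesgue"
proof (rule null_sets_uniform_approx[where m = "CARD('m)" and K = "10 ^ CARD('m)"
      and d = "\<lambda>q \<gamma>. distZ (A *v ivec q - \<gamma>)" and S = unit_cube])
  show "Omega_A A \<subseteq> unit_cube"
    using Omega_unit(2) by (auto simp: Omega_A_def)
  show "\<exists>T\<in>sets lborel. {\<gamma> \<in> unit_cube. distZ (A *v ivec q - \<gamma>) < \<delta>} \<subseteq> T \<and>
      emeasure lborel T \<le> ennreal (10 ^ CARD('m) * \<delta> ^ CARD('m))"
    if \<delta>: "0 < \<delta>" "\<delta> \<le> 1" for q :: "int^'n" and \<delta>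
  proof (rule emeasure_distZ_shift_less[OF \<delta>, of "A *v ivec q"])
    fix T assume "T \<in> sets lborel" "{\<gamma> \<in> unit_cube. distZ (A *v ivec q - \<gamma>) < \<delta>} \<subseteq> T"
      "emeasure lborel T \<le> ennreal ((10 * \<delta>) ^ CARD('m))"
    then show ?thesis unfolding power_mult_distrib by (intro bexI[of _ T] conjI)
  qed
  show "\<forall>\<^sub>F k in sequentially. \<exists>q. q \<noteq> 0 \<and> isupnorm q \<le> k \<and>
      real k ^ CARD('n) * distZ (A *v ivec q - \<gamma>) ^ CARD('m) < c"
    if "\<gamma> \<in> Omega_A A" "0 < c" for \<gamma> c
    using Omega_uniform[of A \<gamma> "{0}" c] that by (simp add: Omega_A_def)
qed auto

text \<open>At q = 0 the inequality does not depend on the matrix, so no small cover exists there in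
  general; \<open>Omega_uniform\<close> is therefore applied with \<open>{0}\<close>
  discarded.\<close>

lemma null_sets_Omega_gamma:
  "(Omega_gamma \<gamma> :: (real^'n^'m) set) \<in> null_sets lebesgue"
proof -
  let ?U = "cbox (\<chi> i j. -1) (\<chi> i j. 1) :: (real^'n^'m) set"
  have U: "emeasure lborel ?U = ennreal (measure lborel ?U)"
    using emeasure_lborel_cbox_finite by (intro emeasure_eq_ennreal_measure) (simp add: less_top)
  show ?thesis
  proof (rule null_sets_uniform_approx[where m = "CARD('m)" and K = "measure lborel ?U * 10 ^ CARD('m)"
        and d = "\<lambda>q A. distZ (A *v ivec q - \<gamma>)" and S = unit_mat])
    show "Omega_gamma \<gamma> \<subseteq> unit_mat"
      using Omega_unit(1) by (auto simp: Omega_gamma_def)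
    show "\<exists>T\<in>sets lborel. {A \<in> unit_mat. distZ (A *v ivec q - \<gamma>) < \<delta>} \<subseteq> T \<and>
        emeasure lborel T \<le> ennreal (measure lborel ?U * 10 ^ CARD('m) * \<delta> ^ CARD('m))"
      if \<delta>: "q \<noteq> 0" "0 < \<delta>" "\<delta> \<le> 1" for q :: "int^'n" and \<delta>
    proof -
      have K: "ennreal (measure lborel ?U * 10 ^ CARD('m) * \<delta> ^ CARD('m))
          = emeasure lborel ?U * ennreal ((10 * \<delta>) ^ CARD('m))"
        using \<delta> by (simp add: U ennreal_mult'[symmetric] power_mult_distrib mult.assoc)
      show ?thesis
      proof (rule emeasure_distZ_matrix_less[OF \<delta>, of \<gamma>])
        fix T assume "T \<in> sets lborel" "{A \<in> unit_mat. distZ (A *v ivec q - \<gamma>) < \<delta>} \<subseteq> T"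
          "emeasure lborel T \<le> emeasure lborel ?U * ennreal ((10 * \<delta>) ^ CARD('m))"
        then show ?thesis unfolding K by (intro bexI[of _ T] conjI)
      qed
    qed
    show "\<forall>\<^sub>F k in sequentially. \<exists>q. q \<noteq> 0 \<and> isupnorm q \<le> k \<and>
        real k ^ CARD('n) * distZ (A *v ivec q - \<gamma>) ^ CARD('m) < c"
      if "A \<in> Omega_gamma \<gamma>" "0 < c" for A :: "real^'n^'m" and c
      using Omega_uniform[of A \<gamma> "{0}" c] that by (simp add: Omega_gamma_def)
  qed auto
qed

theorem theorem1p3:
  shows "(\<Union>\<gamma>\<in>unit_cube. Omega_gamma \<gamma>) = (unit_mat :: (real^'n^'m) set) - Bad0
    \<and> (\<forall>A \<in> (unit_mat :: (real^'n^'m) set). Omega_A A = {} \<longleftrightarrow> A \<in> Bad0)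
    \<and> (\<forall>\<gamma> \<in> (unit_cube :: (real^'m) set). (Omega_gamma \<gamma> :: (real^'n^'m) set) \<in> null_sets lebesgue)
    \<and> (\<forall>A \<in> (unit_mat :: (real^'n^'m) set). Omega_A A \<in> null_sets lebesgue)"
proof -
  have iff: "(\<exists>\<gamma>. (A, \<gamma>) \<in> Omega) \<longleftrightarrow> A \<notin> Bad0" if "A \<in> unit_mat" for A :: "real^'n^'m"
    using that Bad0_not_Omega not_Bad0_Omega by metis
  then have "(\<Union>\<gamma>\<in>unit_cube. Omega_gamma \<gamma>) = (unit_mat :: (real^'n^'m) set) - Bad0"
    using Omega_unit unfolding Omega_gamma_def by fast
  moreover have "Omega_A A = {} \<longleftrightarrow> A \<in> Bad0" if "A \<in> unit_mat" for A :: "real^'n^'m"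
    using iff[OF that] by (auto simp: Omega_A_def)
  ultimately show ?thesis
    using null_sets_Omega_gamma null_sets_Omega_A by blast
qed

end
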